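(* Let $\Gamma$ be a countable discrete sofic group with sofic approximation $\sigma_i\colon\Gamma\to S_{d_i}$. Let $X$ be a compact metrizable space with $\Gamma\curvearrowright X$ by homeomorphisms, and let $k\in\mathbb{N}$. For any $1\le q_1,q_2\le\infty$ we have $$\mathrm{IE}^k_{(\sigma_i)_i}(q_1)=\mathrm{IE}^k_{(\sigma_i)_i}(q_2).$$
   Context: For $n\in\mathbb{N}$, $u_n$ is the uniform probability measure on $\{1,\dots,n\}$ and $S_n$ is the symmetric group. A sofic approximation of a countable discrete group $\Gamma$ is a sequence of functions (not assumed to be homomorphisms) $\sigma_i\colon\Gamma\to S_{d_i}$ such that $u_{d_i}(\{j:\sigma_i(gh)(j)=\sigma_i(g)\sigma_i(h)(j)\})\to 1$ for all $g,h\in\Gamma$ and $u_{d_i}(\{j:\sigma_i(g)(j)\ne j\})\to 1$ for all $g\in\Gamma\setminus\{e\}$. $\Gamma$ is sofic if it has a sofic approximation. A continuous pseudometric $\rho$ on $X$ is dynamically generating if for all $x\ne y$ there is $g\in\Gamma$ with $\rho(gx,gy)>0$. For a finite set $A$ and $\phi,\psi\in X^A$, let $\rho_{q,A}(\phi,\psi)^q=\frac1{|A|}\sum_{a\in A}\rho(\phi(a),\psi(a))^q$ for $1\le q<\infty$ and $\rho_{\infty,A}(\phi,\psi)=\max_{a\in A}\rho(\phi(a),\psi(a))$; $\rho_{q,d}$ means $\rho_{q,\{1,\dots,d\}}$. For finite $F\subseteq\Gamma$, $\delta>0$, $\mathrm{Map}(\rho,F,\delta,\sigma_i)$ is the set of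 $\phi\in X^{d_i}$ with $\max_{g\in F}\rho_{2,d_i}(\phi\circ\sigma_i(g),g\phi)<\delta$, where $(g\phi)(j)=g\phi(j)$. Let $x=(x_1,\dots,x_k)\in X^k$, $1\le q\le\infty$, $F,K\subseteq\Gamma$ finite, $\delta,\varepsilon>0$. A set $J\subseteq\{1,\dots,d_i\}$ is an $\ell^q$-$(\rho,F,\delta,\sigma_i;\varepsilon,K)$-independence set for $x$ if for every $c\colon J\to\{1,\dots,k\}$ there is $\phi\in\mathrm{Map}(\rho,F,\delta,\sigma_i)$ with $\max_{g\in K}\rho_{q,J}(g\phi(\cdot),gx_{c(\cdot)})<\varepsilon$. Let $I_q(x,\rho,F,\delta,\sigma_i;\varepsilon,K)$ be the maximum of $u_{d_i}(J)$ over such $J$ ($0$ if there are none), and $$I_q(x,\rho,(\sigma_i)_i;\varepsilon,K)=\inf_{F,\delta}\limsup_{i\to\infty}I_q(x,\rho,F,\delta,\sigma_i;\varepsilon,K),$$ infimum over finite $F\subseteq\Gamma$ and $\delta>0$. $x$ is an $\ell^q$-$\mathrm{IE}$-tuple with respect to $\rho$ if $I_q(x,\rho,(\sigma_i)_i;\varepsilon,K)>0$ for all $\varepsilon>0$ and finite $K\subseteq\Gamma$; the set of these is $\mathrm{IE}^k_{(\sigma_i)_i,\rho}(q)$. It does not depend on the continuous dynamically generating pseudometric $\rho$ and is denoted $\mathrm{IE}^k_{(\sigma_i)_i}(q)$. *)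

theory Defs
  imports
    "HOL-Analysis.Analysis"
    "HOL-Algebra.Group_Action"
    "HOL-Algebra.Sym_Groups"
begin

definition unif :: "nat \<Rightarrow> nat set \<Rightarrow> real" where
  "unif n A = measure (uniform_count_measure {1..n}) A"

definition sofic_approximation ::
  "('g, 'm) monoid_scheme \<Rightarrow> (nat \<Rightarrow> nat) \<Rightarrow> (nat \<Rightarrow> 'g \<Rightarrow> nat \<Rightarrow> nat) \<Rightarrow> bool" where
  "sofic_approximation G d \<sigma> \<longleftrightarrow>
     (\<forall>i. 1 \<le> d i) \<and>
     (\<forall>i. \<forall>g\<in>carrier G. \<sigma> i g \<in> carrier (sym_group (d i))) \<and>
     (\<forall>g\<in>carrier G. \<forall>h\<in>carrier G.
        (\<lambda>i. unif (d i) {j \<in> {1..d i}. \<sigma> i (g \<otimes>\<^bsub>G\<^esub> h) j = \<sigma> i g (\<sigma> i h j)}) \<longlonglongrightarrow> 1) \<and>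
     (\<forall>g\<in>carrier G - {\<one>\<^bsub>G\<^esub>}.
        (\<lambda>i. unif (d i) {j \<in> {1..d i}. \<sigma> i g j \<noteq> j}) \<longlonglongrightarrow> 1)"

definition action_by_homeomorphisms ::
  "('g, 'm) monoid_scheme \<Rightarrow> 'x topology \<Rightarrow> ('g \<Rightarrow> 'x \<Rightarrow> 'x) \<Rightarrow> bool" where
  "action_by_homeomorphisms G X \<alpha> \<longleftrightarrow>
     group_action G (topspace X) \<alpha> \<and> (\<forall>g\<in>carrier G. homeomorphic_map X X (\<alpha> g))"

definition continuous_pseudometric :: "'x topology \<Rightarrow> ('x \<Rightarrow> 'x \<Rightarrow> real) \<Rightarrow> bool" where
  "continuous_pseudometric X \<rho> \<longleftrightarrow>
     (\<forall>x\<in>topspace X. \<forall>y\<in>topspace X. 0 \<le> \<rho> x y) \<and>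
     (\<forall>x\<in>topspace X. \<rho> x x = 0) \<and>
     (\<forall>x\<in>topspace X. \<forall>y\<in>topspace X. \<rho> x y = \<rho> y x) \<and>
     (\<forall>x\<in>topspace X. \<forall>y\<in>topspace X. \<forall>z\<in>topspace X. \<rho> x z \<le> \<rho> x y + \<rho> y z) \<and>
     continuous_map (prod_topology X X) euclideanreal (\<lambda>(x, y). \<rho> x y)"

definition dynamically_generating ::
  "('g, 'm) monoid_scheme \<Rightarrow> 'x topology \<Rightarrow> ('g \<Rightarrow> 'x \<Rightarrow> 'x) \<Rightarrow> ('x \<Rightarrow> 'x \<Rightarrow> real) \<Rightarrow> bool" where
  "dynamically_generating G X \<alpha> \<rho> \<longleftrightarrow>
     (\<forall>x\<in>topspace X. \<forall>y\<in>topspace X. x \<noteq> y \<longrightarrow> (\<exists>g\<in>carrier G. 0 < \<rho> (\<alpha> g x) (\<alpha> g y)))"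

text \<open>
  The value for empty \<open>A\<close> is 0 for every \<open>q\<close> (for finite \<open>q\<close> because of \<open>1 / 0 = 0\<close>).
\<close>

definition rho_dist ::
  "('x \<Rightarrow> 'x \<Rightarrow> real) \<Rightarrow> ereal \<Rightarrow> 'a set \<Rightarrow> ('a \<Rightarrow> 'x) \<Rightarrow> ('a \<Rightarrow> 'x) \<Rightarrow> real" where
  "rho_dist \<rho> q A \<phi> \<psi> =
     (if q = \<infinity>
      then (if A = {} then 0 else Max ((\<lambda>a. \<rho> (\<phi> a) (\<psi> a)) ` A))
      else (1 / real (card A) * (\<Sum>a\<in>A. \<rho> (\<phi> a) (\<psi> a) powr real_of_ereal q))
             powr (1 / real_of_ereal q))"

text \<open>
  In the next two definitions, a bound on a maximum over a finite subset of the group is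
  written as a bound for each element, so that it is vacuous for the empty set.
  The arguments \<open>n\<close> and \<open>s\<close> stand for \<open>d i\<close> and \<open>\<sigma> i\<close> at a fixed index \<open>i\<close>.
\<close>

definition Map_approx ::
  "'x topology \<Rightarrow> ('g \<Rightarrow> 'x \<Rightarrow> 'x) \<Rightarrow> ('x \<Rightarrow> 'x \<Rightarrow> real) \<Rightarrow> 'g set \<Rightarrow> real \<Rightarrow>
   nat \<Rightarrow> ('g \<Rightarrow> nat \<Rightarrow> nat) \<Rightarrow> (nat \<Rightarrow> 'x) set" where
  "Map_approx X \<alpha> \<rho> F \<delta> n s =
     {\<phi> \<in> {1..n} \<rightarrow>\<^sub>E topspace X.
        \<forall>g\<in>F. rho_dist \<rho> 2 {1..n} (\<phi> \<circ> s g) (\<lambda>j. \<alpha> g (\<phi> j)) < \<delta>}"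

definition independence_set ::
  "'x topology \<Rightarrow> ('g \<Rightarrow> 'x \<Rightarrow> 'x) \<Rightarrow> ('x \<Rightarrow> 'x \<Rightarrow> real) \<Rightarrow> nat \<Rightarrow> ereal \<Rightarrow> (nat \<Rightarrow> 'x) \<Rightarrow>
   'g set \<Rightarrow> real \<Rightarrow> nat \<Rightarrow> ('g \<Rightarrow> nat \<Rightarrow> nat) \<Rightarrow> real \<Rightarrow> 'g set \<Rightarrow> nat set \<Rightarrow> bool" where
  "independence_set X \<alpha> \<rho> k q x F \<delta> n s \<epsilon> K J \<longleftrightarrow>
     J \<subseteq> {1..n} \<and>
     (\<forall>c \<in> J \<rightarrow> {1..k}. \<exists>\<phi> \<in> Map_approx X \<alpha> \<rho> F \<delta> n s.
        \<forall>g\<in>K. rho_dist \<rho> q J (\<lambda>j. \<alpha> g (\<phi> j)) (\<lambda>j. \<alpha> g (x (c j))) < \<epsilon>)"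

definition indep_density_at ::
  "'x topology \<Rightarrow> ('g \<Rightarrow> 'x \<Rightarrow> 'x) \<Rightarrow> ('x \<Rightarrow> 'x \<Rightarrow> real) \<Rightarrow> nat \<Rightarrow> ereal \<Rightarrow> (nat \<Rightarrow> 'x) \<Rightarrow>
   'g set \<Rightarrow> real \<Rightarrow> nat \<Rightarrow> ('g \<Rightarrow> nat \<Rightarrow> nat) \<Rightarrow> real \<Rightarrow> 'g set \<Rightarrow> real" where
  "indep_density_at X \<alpha> \<rho> k q x F \<delta> n s \<epsilon> K =
     (if \<exists>J. independence_set X \<alpha> \<rho> k q x F \<delta> n s \<epsilon> K J
      then Max (unif n ` {J. independence_set X \<alpha> \<rho> k q x F \<delta> n s \<epsilon> K J})
      else 0)"

definition indep_density ::
  "('g, 'm) monoid_scheme \<Rightarrow> 'x topology \<Rightarrow> ('g \<Rightarrow> 'x \<Rightarrow> 'x) \<Rightarrow> (nat \<Rightarrow> nat) \<Rightarrow>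
   (nat \<Rightarrow> 'g \<Rightarrow> nat \<Rightarrow> nat) \<Rightarrow> ('x \<Rightarrow> 'x \<Rightarrow> real) \<Rightarrow> nat \<Rightarrow> ereal \<Rightarrow> (nat \<Rightarrow> 'x) \<Rightarrow>
   real \<Rightarrow> 'g set \<Rightarrow> ereal" where
  "indep_density G X \<alpha> d \<sigma> \<rho> k q x \<epsilon> K =
     (INF (F, \<delta>) \<in> {F. finite F \<and> F \<subseteq> carrier G} \<times> {0<..}.
        limsup (\<lambda>i. ereal (indep_density_at X \<alpha> \<rho> k q x F \<delta> (d i) (\<sigma> i) \<epsilon> K)))"

text \<open>The power \<open>X\<^sup>k\<close> is the set of extensional functions from \<open>{1..k}\<close> to \<open>topspace X\<close>.\<close>

definition IE_tuples ::
  "('g, 'm) monoid_scheme \<Rightarrow> 'x topology \<Rightarrow> ('g \<Rightarrow> 'x \<Rightarrow> 'x) \<Rightarrow> (nat \<Rightarrow> nat) \<Rightarrow>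
   (nat \<Rightarrow> 'g \<Rightarrow> nat \<Rightarrow> nat) \<Rightarrow> ('x \<Rightarrow> 'x \<Rightarrow> real) \<Rightarrow> nat \<Rightarrow> ereal \<Rightarrow> (nat \<Rightarrow> 'x) set" where
  "IE_tuples G X \<alpha> d \<sigma> \<rho> k q =
     {x \<in> {1..k} \<rightarrow>\<^sub>E topspace X.
        \<forall>\<epsilon>>0. \<forall>K. finite K \<and> K \<subseteq> carrier G \<longrightarrow> 0 < indep_density G X \<alpha> d \<sigma> \<rho> k q x \<epsilon> K}"

end

theory Submission
  imports Defs
begin

text \<open>
  By symmetry it suffices to pass from \<open>(\<rho>, q)\<close> to \<open>(\<rho>', q')\<close>. Compactness of \<open>X \<times> X\<close> and the
  generating property show that \<open>\<rho>'\<close> is small as soon as \<open>\<rho>\<close> is small along a finite set of group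
  elements; combined with soficity this makes the maps that are approximately equivariant for \<open>\<rho>\<close>
  approximately equivariant for \<open>\<rho>'\<close> at all late stages. If \<open>J\<close> is an \<open>\<ell>\<^sup>q\<close>-independence set, then by
  Markov's inequality each labelling of \<open>J\<close> is modelled pointwise outside a small bad subset of
  \<open>J\<close>. Pigeonhole over the bad sets and a Sauer--Shelah argument give a subset of \<open>J\<close> of
  proportional size all of whose labellings are modelled pointwise, which is an independence set
  for every exponent.
\<close>

section \<open>Shattering and the extraction of large independent sets of positions\<close>

text \<open>For a two-letter alphabet this is the usual shattering of set systems. Values are
  compared on \<open>W\<close> only, so members of \<open>C\<close> may live on a larger
  set.\<close>

definition shatters :: "('a \<Rightarrow> 'b) set \<Rightarrow> 'b set \<Rightarrow> 'a set \<Rightarrow> bool" where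
  "shatters C A W \<longleftrightarrow> (\<forall>c\<in>W \<rightarrow> A. \<exists>f\<in>C. \<forall>w\<in>W. f w = c w)"

text \<open>
  Sauer--Shelah for a larger alphabet. Deleting a coordinate, \<open>card C\<close> is at most \<open>card A - 1\<close> times
  the size of the projection \<open>P\<close> plus the number \<open>card Q\<close> of points whose whole fibre lies in \<open>C\<close>.
\<close>

lemma card_le_sum_shattered:
  assumes "finite J" "finite A" "A \<noteq> {}" "C \<subseteq> J \<rightarrow>\<^sub>E A"
  shows "card C \<le> (\<Sum>W | W \<subseteq> J \<and> shatters C A W. (card A - 1) ^ (card J - card W))"
  using assms(1,4)
proof (induction J arbitrary: C rule: finite_induct)
  case empty
  then consider "C = {}" | "C = {\<lambda>_. undefined}" by auto
  then show ?case
  proof cases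
    case 2
    \<comment> \<open>The only term has exponent 0, and it counts 1 even for a one-letter alphabet
      because \<open>0 ^ 0 = 1\<close>.\<close>
    have "{W. W \<subseteq> {} \<and> shatters C A W} = {{}}" by (auto simp: 2 shatters_def)
    then show ?thesis by (simp add: 2)
  qed simp
next
  case (insert a J)
  let ?k = "card A - 1"
  let ?sh = "\<lambda>J C. {W. W \<subseteq> J \<and> shatters C A W}"
  \<comment> \<open>Resetting the value at \<open>a\<close> to \<open>undefined\<close> keeps the
    projection extensional on \<open>J\<close>, as the induction hypothesis requires.\<close>
  define P where "P = (\<lambda>f. f(a := undefined)) ` C"
  define Q where "Q = {p \<in> P. \<forall>v\<in>A. p(a := v) \<in> C}"
  have finC: "finite C" using insert.prems insert.hyps assms(2) by (meson finite_PiE finite_insert finite_subset)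
  then have finP: "finite P" by (simp add: P_def)
  have P: "P \<subseteq> J \<rightarrow>\<^sub>E A"
    using insert.prems insert.hyps
    by (auto simp: P_def PiE_def extensional_def Pi_iff subset_iff)
  then have Q: "Q \<subseteq> J \<rightarrow>\<^sub>E A" by (auto simp: Q_def)
  have CS: "C = (\<lambda>(p, v). p(a := v)) ` (SIGMA p:P. {v \<in> A. p(a := v) \<in> C})"
  proof (intro equalityI subsetI)
    fix f assume f: "f \<in> C"
    then have "f a \<in> A" using insert.prems by auto
    then have "(f(a := undefined), f a) \<in> (SIGMA p:P. {v \<in> A. p(a := v) \<in> C})"
      using f by (auto simp: P_def)
    then show "f \<in> (\<lambda>(p, v). p(a := v)) ` (SIGMA p:P. {v \<in> A. p(a := v) \<in> C})"
      by (rule rev_image_eqI) simp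
  qed auto
  have "card C \<le> card (SIGMA p:P. {v \<in> A. p(a := v) \<in> C})"
    by (subst CS, rule card_image_le) (use finP assms(2) in auto)
  also have "\<dots> = (\<Sum>p\<in>P. card {v \<in> A. p(a := v) \<in> C})"
    using finP assms(2) by (simp add: card_SigmaI)
  \<comment> \<open>A fibre that is not full misses a letter and has at most \<open>?k\<close>
    elements; a full one has at most one more.\<close>
  also have "\<dots> \<le> (\<Sum>p\<in>P. ?k + (if p \<in> Q then 1 else 0))"
  proof (rule sum_mono)
    fix p assume p: "p \<in> P"
    show "card {v \<in> A. p(a := v) \<in> C} \<le> ?k + (if p \<in> Q then 1 else 0)"
    proof (cases "p \<in> Q")
      case True
      then show ?thesis using card_mono[OF assms(2), of "{v \<in> A. p(a := v) \<in> C}"] by auto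
    next
      case False
      then have "{v \<in> A. p(a := v) \<in> C} \<subset> A" using p by (auto simp: Q_def)
      then have "card {v \<in> A. p(a := v) \<in> C} < card A" using assms(2) by (rule psubset_card_mono[rotated])
      then show ?thesis by simp
    qed
  qed
  also have "\<dots> = ?k * card P + card Q"
  proof -
    have "P \<inter> Q = Q" by (auto simp: Q_def)
    then show ?thesis using finP by (simp add: sum.distrib flip: sum.inter_restrict)
  qed
  also have "\<dots> \<le> ?k * (\<Sum>W\<in>?sh J P. ?k ^ (card J - card W)) + (\<Sum>W\<in>?sh J Q. ?k ^ (card J - card W))"
    by (intro add_mono mult_le_mono insert.IH P Q) simp
  \<comment> \<open>Sets shattered by \<open>P\<close> are kept while the ground set gains a point,
    so the exponent grows by one and absorbs the factor \<open>?k\<close>.\<close>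
  also have "?k * (\<Sum>W\<in>?sh J P. ?k ^ (card J - card W))
      = (\<Sum>W\<in>?sh J P. ?k ^ (card (insert a J) - card W))"
    using insert.hyps
    by (auto simp: sum_distrib_left Suc_diff_le card_mono intro!: sum.cong)
  \<comment> \<open>Sets shattered by \<open>Q\<close> gain the point \<open>a\<close>; they and the
    ground set both grow by one, so the exponent is unchanged.\<close>
  also have "(\<Sum>W\<in>?sh J Q. ?k ^ (card J - card W))
      = (\<Sum>W\<in>insert a ` ?sh J Q. ?k ^ (card (insert a J) - card W))"
  proof (subst sum.reindex)
    show "inj_on (insert a) (?sh J Q)"
    proof (rule inj_onI)
      fix V W assume "V \<in> ?sh J Q" "W \<in> ?sh J Q" and eq: "insert a V = insert a W"
      then have "a \<notin> V" "a \<notin> W" using insert.hyps by auto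
      then show "V = W" using eq by (metis insert_ident)
    qed
    show "(\<Sum>W\<in>?sh J Q. ?k ^ (card J - card W))
      = sum ((\<lambda>W. ?k ^ (card (insert a J) - card W)) \<circ> insert a) (?sh J Q)"
    proof (rule sum.cong)
      fix W assume "W \<in> ?sh J Q"
      then have "finite W" "a \<notin> W" using insert.hyps by (auto intro: finite_subset)
      then show "?k ^ (card J - card W) = ((\<lambda>W. ?k ^ (card (insert a J) - card W)) \<circ> insert a) W"
        using insert.hyps by simp
    qed simp
  qed
  also have "(\<Sum>W\<in>?sh J P. ?k ^ (card (insert a J) - card W))
       + (\<Sum>W\<in>insert a ` ?sh J Q. ?k ^ (card (insert a J) - card W))
      = (\<Sum>W\<in>?sh J P \<union> insert a ` ?sh J Q. ?k ^ (card (insert a J) - card W))"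
    by (rule sum.union_disjoint[symmetric]) (use insert.hyps in auto)
  also have "\<dots> \<le> (\<Sum>W\<in>?sh (insert a J) C. ?k ^ (card (insert a J) - card W))"
  proof (rule sum_mono2)
    show "finite (?sh (insert a J) C)" using insert.hyps by simp
    have "shatters C A W" if W: "W \<subseteq> J" "shatters P A W" for W
      unfolding shatters_def
    proof
      fix c assume "c \<in> W \<rightarrow> A"
      then obtain p where p: "p \<in> P" "\<forall>w\<in>W. p w = c w" using W by (auto simp: shatters_def)
      then obtain f where f: "f \<in> C" "p = f(a := undefined)" by (auto simp: P_def)
      have "\<forall>w\<in>W. f w = c w" using p f W insert.hyps by (metis fun_upd_other subsetD)
      then show "\<exists>f\<in>C. \<forall>w\<in>W. f w = c w" using f by blast
    qed
    \<comment> \<open>A member of \<open>Q\<close> may take any letter at \<open>a\<close> without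
      leaving \<open>C\<close>.\<close>
    moreover have "shatters C A (insert a W)" if W: "W \<subseteq> J" "shatters Q A W" for W
      unfolding shatters_def
    proof
      fix c assume c: "c \<in> insert a W \<rightarrow> A"
      then obtain p where p: "p \<in> Q" "\<forall>w\<in>W. p w = c w" using W unfolding shatters_def by blast
      have "p(a := c a) \<in> C" using p c by (auto simp: Q_def)
      moreover have "\<forall>w\<in>insert a W. (p(a := c a)) w = c w" using p by auto
      ultimately show "\<exists>f\<in>C. \<forall>w\<in>insert a W. f w = c w" by blast
    qed
    ultimately show "?sh J P \<union> insert a ` ?sh J Q \<subseteq> ?sh (insert a J) C" by auto
  qed simp
  finally show ?case .
qed

text \<open>Exponential weighting: with weight \<open>t ^ card W\<close>, each small subset weighs
  at least \<open>t powr m\<close> because \<open>t \<le> 1\<close>, and the weights of all subsets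
  sum to \<open>(1 + t) ^ card J\<close>.\<close>

lemma card_small_subsets:
  fixes t m :: real
  assumes "finite J" "0 < t" "t \<le> 1"
  shows "real (card {W. W \<subseteq> J \<and> real (card W) \<le> m}) * t powr m \<le> (1 + t) ^ card J"
proof -
  let ?S = "{W. W \<subseteq> J \<and> real (card W) \<le> m}"
  have "real (card ?S) * t powr m = (\<Sum>W\<in>?S. t powr m)" by simp
  also have "\<dots> \<le> (\<Sum>W\<in>?S. t ^ card W)"
  proof (rule sum_mono)
    fix W assume "W \<in> ?S"
    then have "t powr m \<le> t powr (real (card W))" using assms by (intro powr_mono') auto
    then show "t powr m \<le> t ^ card W" using assms by (simp add: powr_realpow)
  qed
  also have "\<dots> \<le> (\<Sum>W\<in>Pow J. t ^ card W)"
    by (rule sum_mono2) (use assms in auto)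
  also have "\<dots> = (\<Prod>j\<in>J. t + 1)"
    using prod_add[OF assms(1), of "\<lambda>_. t" "\<lambda>_. 1"] by simp
  finally show ?thesis by (simp add: add.commute)
qed

text \<open>
  Combinatorial core: \<open>B f\<close> is the set of positions where the labelling \<open>f\<close> is badly modelled.
  By pigeonhole many \<open>f\<close> share the same bad set \<open>T\<close>; they shatter a set larger than \<open>2 * \<kappa> * card J\<close>,
  from which \<open>T\<close> can be removed. The choice of \<open>\<kappa>\<close> makes the squared number of subsets of size
  at most \<open>2 * \<kappa> * n\<close> smaller than \<open>(k / (k - 1)) ^ n\<close>.
\<close>

lemma independence_constant:
  assumes "1 \<le> (k::nat)"
  obtains \<kappa> :: real where "0 < \<kappa>"
    and "\<And>(J :: 'a set) (B :: ('a \<Rightarrow> 'b) \<Rightarrow> 'a set) A. \<lbrakk>finite J; finite A; card A = k;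
        \<And>f. f \<in> J \<rightarrow>\<^sub>E A \<Longrightarrow> B f \<subseteq> J \<and> real (card (B f)) \<le> \<kappa> * real (card J)\<rbrakk> \<Longrightarrow>
        \<exists>W\<subseteq>J. \<kappa> * real (card J) \<le> real (card W) \<and>
          (\<forall>c\<in>W \<rightarrow> A. \<exists>f\<in>J \<rightarrow>\<^sub>E A. (\<forall>w\<in>W. f w = c w) \<and> W \<inter> B f = {})"
proof (cases "k = 1")
  case True
  show ?thesis
  proof (rule that[of "1/2"])
    fix J :: "'a set" and B :: "('a \<Rightarrow> 'b) \<Rightarrow> 'a set" and A
    assume fin: "finite J" "finite A" and k: "card A = k"
      and B: "\<And>f. f \<in> J \<rightarrow>\<^sub>E A \<Longrightarrow> B f \<subseteq> J \<and> real (card (B f)) \<le> 1/2 * real (card J)"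
    obtain v where v: "A = {v}" using k True by (auto simp: card_1_singleton_iff)
    define f where "f = (\<lambda>j\<in>J. v)"
    have f: "f \<in> J \<rightarrow>\<^sub>E A" by (auto simp: f_def v)
    have "card (J - B f) = card J - card (B f)" "card (B f) \<le> card J"
      using B[OF f] fin by (auto intro: card_Diff_subset finite_subset card_mono)
    then have "1/2 * real (card J) \<le> real (card (J - B f))" using B[OF f] by simp
    moreover have "\<exists>h\<in>J \<rightarrow>\<^sub>E A. (\<forall>w\<in>J - B f. h w = c w) \<and> (J - B f) \<inter> B h = {}"
      if "c \<in> (J - B f) \<rightarrow> A" for c
      using that f by (intro bexI[of _ f]) (auto simp: f_def v Pi_iff)
    ultimately show "\<exists>W\<subseteq>J. 1/2 * real (card J) \<le> real (card W) \<and>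
          (\<forall>c\<in>W \<rightarrow> A. \<exists>f\<in>J \<rightarrow>\<^sub>E A. (\<forall>w\<in>W. f w = c w) \<and> W \<inter> B f = {})"
      by (intro exI[of _ "J - B f"]) auto
  qed simp
next
  case False
  then have k2: "2 \<le> k" using assms by simp
  define r where "r = real k / real (k - 1)"
  have r: "1 < r" "r \<le> 2" using k2 by (auto simp: r_def field_simps of_nat_diff)
  \<comment> \<open>Now \<open>(1 + t) ^ 4 = r\<close>, so \<open>(1 + t) ^ 2\<close> is only the
    square root of \<open>r\<close>. This leaves room for the factor
    \<open>t powr (- 4 * \<kappa>)\<close>, which tends to 1 as \<kappa> tends to 0.\<close>
  define t where "t = r powr (1/4) - 1"
  have t0: "0 < t" using r by (simp add: t_def)
  have "r powr (1/4) \<le> r powr 1" using r by (intro powr_mono) auto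
  then have t1: "t \<le> 1" using r by (simp add: t_def)
  have "((\<lambda>\<kappa>. (1 + t) powr 2 * t powr (- 4 * \<kappa>)) \<longlongrightarrow> (1 + t) powr 2 * t powr (- 4 * 0)) (at_right 0)"
    using t0 by (intro tendsto_intros) auto
  moreover have "(1 + t) powr 2 * t powr (- 4 * 0) < r"
  proof -
    have "(1 + t) powr 2 = r powr (1/2)" by (simp add: t_def powr_powr)
    also have "\<dots> < r powr 1" using r by (intro powr_less_mono) auto
    finally show ?thesis using t0 r by simp
  qed
  ultimately have "\<forall>\<^sub>F \<kappa> in at_right 0. (1 + t) powr 2 * t powr (- 4 * \<kappa>) < r"
    by (rule order_tendstoD)
  moreover have "\<forall>\<^sub>F \<kappa> in at_right (0::real). 0 < \<kappa>" by (simp add: eventually_at_right_less)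
  ultimately have "\<forall>\<^sub>F \<kappa> in at_right 0. 0 < \<kappa> \<and> (1 + t) powr 2 * t powr (- 4 * \<kappa>) < r"
    by eventually_elim simp
  then obtain \<kappa> where \<kappa>: "0 < \<kappa>" "(1 + t) powr 2 * t powr (- 4 * \<kappa>) < r"
    by (metis (mono_tags, lifting) eventually_happens' trivial_limit_at_right_real)
  show ?thesis
  proof (rule that[OF \<kappa>(1)])
    fix J :: "'a set" and B :: "('a \<Rightarrow> 'b) \<Rightarrow> 'a set" and A
    assume fin: "finite J" "finite A" and k: "card A = k"
      and B: "\<And>f. f \<in> J \<rightarrow>\<^sub>E A \<Longrightarrow> B f \<subseteq> J \<and> real (card (B f)) \<le> \<kappa> * real (card J)"
    have A: "A \<noteq> {}" using k k2 by auto
    define n where "n = card J"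
    \<comment> \<open>\<open>S\<close> plays two roles: it contains every bad set, and in the proof
      by contradiction every shattered set. The second role dictates the bound with factor
      2.\<close>
    define S where "S = {W. W \<subseteq> J \<and> real (card W) \<le> 2 * \<kappa> * n}"
    have finS: "finite S" using fin by (simp add: S_def)
    have BS: "B f \<in> S" if "f \<in> J \<rightarrow>\<^sub>E A" for f
      using B[OF that] \<kappa> by (auto simp: S_def n_def intro: order_trans)
    show "\<exists>W\<subseteq>J. \<kappa> * real (card J) \<le> real (card W) \<and>
          (\<forall>c\<in>W \<rightarrow> A. \<exists>f\<in>J \<rightarrow>\<^sub>E A. (\<forall>w\<in>W. f w = c w) \<and> W \<inter> B f = {})"
    \<comment> \<open>The strict comparison of \<open>n\<close>-th powers below needs a positive
      \<open>n\<close>.\<close>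
    proof (cases "n = 0")
      case True
      then have J: "J = {}" using fin by (simp add: n_def)
      show ?thesis using B J by (intro exI[of _ "{}"]) auto
    next
      case False
      let ?C = "\<lambda>T. {f \<in> J \<rightarrow>\<^sub>E A. B f = T}"
      have "\<exists>T\<in>S. \<exists>W\<subseteq>J. shatters (?C T) A W \<and> 2 * \<kappa> * n < card W"
      proof (rule ccontr)
        assume neg: "\<not> ?thesis"
        \<comment> \<open>Under the negated claim all sets shattered by \<open>?C T\<close> lie in
          \<open>S\<close>, and each contributes at most \<open>(k - 1) ^ n\<close> to the
          Sauer--Shelah sum.\<close>
        have C: "card (?C T) \<le> card S * (k - 1) ^ n" if T: "T \<in> S" for T
        proof -
          have "card (?C T) \<le> (\<Sum>W | W \<subseteq> J \<and> shatters (?C T) A W. (card A - 1) ^ (card J - card W))"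
            by (rule card_le_sum_shattered) (use fin A in auto)
          also have "\<dots> \<le> (\<Sum>W | W \<subseteq> J \<and> shatters (?C T) A W. (k - 1) ^ n)"
            using k2 k by (intro sum_mono) (auto simp: n_def intro!: power_increasing)
          also have "\<dots> = card {W. W \<subseteq> J \<and> shatters (?C T) A W} * (k - 1) ^ n" by simp
          also have "\<dots> \<le> card S * (k - 1) ^ n"
            using neg T finS by (intro mult_le_mono card_mono) (auto simp: S_def not_less)
          finally show ?thesis .
        qed
        have "k ^ n = card (J \<rightarrow>\<^sub>E A)" using fin k by (simp add: card_PiE n_def)
        also have "J \<rightarrow>\<^sub>E A = (\<Union>T\<in>S. ?C T)" using BS by auto
        also have "card \<dots> \<le> (\<Sum>T\<in>S. card (?C T))" using finS by (rule card_UN_le)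
        also have "\<dots> \<le> (\<Sum>T\<in>S. card S * (k - 1) ^ n)" using C by (rule sum_mono)
        also have "\<dots> = card S ^ 2 * (k - 1) ^ n" by (simp add: power2_eq_square)
        finally have "real (k ^ n) \<le> real (card S ^ 2 * (k - 1) ^ n)" by (rule of_nat_mono)
        then have le: "r ^ n \<le> real (card S) ^ 2"
          using k2 by (simp add: r_def power_divide divide_le_eq)
        have "real (card S) * t powr (2 * \<kappa> * n) \<le> (1 + t) ^ n"
          using card_small_subsets[OF fin(1) t0 t1] unfolding S_def n_def .
        then have "real (card S) \<le> (1 + t) ^ n * t powr (- (2 * \<kappa> * n))"
          using t0 by (simp add: powr_minus field_simps)
        then have "real (card S) ^ 2 \<le> ((1 + t) ^ n * t powr (- (2 * \<kappa> * n))) ^ 2"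
          by (rule power_mono) simp
        also have "\<dots> = ((1 + t) powr 2 * t powr (- 4 * \<kappa>)) ^ n"
          using t0 by (simp add: power_mult_distrib powr_power mult_ac flip: power_mult)
        also have "\<dots> < r ^ n" using \<kappa> False t0 by (intro power_strict_mono) auto
        finally show False using le by simp
      qed
      then obtain T W where T: "T \<in> S" and W: "W \<subseteq> J" "shatters (?C T) A W" "2 * \<kappa> * n < card W" by blast
      \<comment> \<open>Membership in \<open>S\<close> bounds \<open>T\<close> only by
        \<open>2 * \<kappa> * n\<close>. Shattering yields a labelling whose bad set is
        \<open>T\<close>, and this gives the sharper bound \<open>\<kappa> * n\<close>.\<close>
      have "\<exists>c. c \<in> W \<rightarrow> A" using A by (auto intro!: exI[of _ "\<lambda>_. SOME v. v \<in> A"] some_in_eq[THEN iffD2])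
      then obtain f where "f \<in> ?C T" using W(2) unfolding shatters_def by blast
      then have cT: "real (card T) \<le> \<kappa> * n" and TJ: "T \<subseteq> J" using B n_def by auto
      have "real (card W) - card T \<le> card (W - T)"
        using diff_card_le_card_Diff[of T W] finite_subset[OF TJ fin(1)] by linarith
      then have 1: "\<kappa> * real (card J) \<le> real (card (W - T))" using cT W(3) by (simp add: n_def)
      have "\<exists>f\<in>J \<rightarrow>\<^sub>E A. (\<forall>w\<in>W - T. f w = c w) \<and> (W - T) \<inter> B f = {}" if c: "c \<in> W - T \<rightarrow> A" for c
      proof -
        obtain v where v: "v \<in> A" using A by auto
        \<comment> \<open>Shattering concerns labellings of all of \<open>W\<close>, so the
          positions in \<open>T\<close> receive an arbitrary letter.\<close>
        have "(\<lambda>w. if w \<in> T then v else c w) \<in> W \<rightarrow> A" using c v by auto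
        from bspec[OF W(2)[unfolded shatters_def] this]
        obtain f where f: "f \<in> ?C T" "\<forall>w\<in>W. f w = (if w \<in> T then v else c w)"
          by blast
        then show ?thesis by (intro bexI[of _ f]) auto
      qed
      then show ?thesis using 1 W(1) by (intro exI[of _ "W - T"]) auto
    qed
  qed
qed

section \<open>Averaged versus pointwise closeness\<close>

text \<open>Markov's inequality for \<open>p\<close>-th powers gives the proportion
  \<open>(e / t) powr p\<close>; for the maximum no large value occurs at all.\<close>

lemma card_large_le_rho_dist:
  assumes "finite A" "1 \<le> q" "0 < e" "e \<le> t"
    and nonneg: "\<And>a. a \<in> A \<Longrightarrow> 0 \<le> \<rho> (\<phi> a) (\<psi> a)"
    and less: "rho_dist \<rho> q A \<phi> \<psi> < e"
  shows "real (card {a \<in> A. t \<le> \<rho> (\<phi> a) (\<psi> a)}) \<le> e / t * real (card A)"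
proof (cases "A = {}")
  case False
  let ?B = "{a \<in> A. t \<le> \<rho> (\<phi> a) (\<psi> a)}"
  have cA: "0 < card A" using assms(1) False by (simp add: card_gt_0_iff)
  show ?thesis
  proof (cases "q = \<infinity>")
    case True
    have "\<rho> (\<phi> a) (\<psi> a) < e" if "a \<in> A" for a
      using less True assms(1) that False by (auto simp: rho_dist_def)
    then have "?B = {}" using assms(4) by force
    then show ?thesis using assms(3,4) by (simp only: card.empty) simp
  next
    case False
    define p where "p = real_of_ereal q"
    have p: "1 \<le> p" using False assms(2) by (cases q) (auto simp: p_def)
    let ?S = "\<Sum>a\<in>A. \<rho> (\<phi> a) (\<psi> a) powr p"
    have "real (card ?B) * t powr p = (\<Sum>a\<in>?B. t powr p)" by simp
    also have "\<dots> \<le> (\<Sum>a\<in>?B. \<rho> (\<phi> a) (\<psi> a) powr p)"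
      using assms(3,4) p by (intro sum_mono powr_mono2) auto
    also have "\<dots> \<le> ?S" by (rule sum_mono2) (use assms(1) in auto)
    finally have 1: "real (card ?B) * t powr p \<le> ?S" .
    have S0: "0 \<le> ?S" by (simp add: sum_nonneg)
    have "(1 / real (card A) * ?S) powr (1 / p) < e"
      using less False by (simp add: rho_dist_def p_def)
    then have "((1 / real (card A) * ?S) powr (1 / p)) powr p < e powr p"
      using p by (intro powr_less_mono2) auto
    then have "1 / real (card A) * ?S < e powr p"
      using p S0 by (simp add: powr_powr)
    then have 2: "?S \<le> e powr p * real (card A)" using cA by (simp add: field_simps)
    have "real (card ?B) \<le> (e powr p * real (card A)) / t powr p"
      using 1 2 assms(3,4) by (simp add: field_simps)
    also have "\<dots> = (e / t) powr p * real (card A)" using assms(3,4) by (simp add: powr_divide)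
    \<comment> \<open>As \<open>e / t \<le> 1\<close> and \<open>1 \<le> p\<close>, lowering the
      exponent to 1 only increases the bound and makes it independent of \<open>q\<close>.\<close>
    also have "\<dots> \<le> (e / t) powr 1 * real (card A)"
      using assms(3,4) p by (intro mult_right_mono powr_mono') auto
    finally show ?thesis using assms(3,4) by simp
  qed
qed simp

lemma rho_dist_less_of_pointwise:
  assumes "finite A" "1 \<le> q" "0 < e"
    and nonneg: "\<And>a. a \<in> A \<Longrightarrow> 0 \<le> \<rho> (\<phi> a) (\<psi> a)"
    and less: "\<And>a. a \<in> A \<Longrightarrow> \<rho> (\<phi> a) (\<psi> a) < e"
  shows "rho_dist \<rho> q A \<phi> \<psi> < e"
proof (cases "A = {} \<or> q = \<infinity>")
  case True
  then show ?thesis using assms by (auto simp: rho_dist_def)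
next
  case False
  define p where "p = real_of_ereal q"
  have p: "1 \<le> p" using False assms(2) by (cases q) (auto simp: p_def)
  have cA: "0 < card A" using assms(1) False by (simp add: card_gt_0_iff)
  let ?S = "\<Sum>a\<in>A. \<rho> (\<phi> a) (\<psi> a) powr p"
  have "?S < (\<Sum>a\<in>A. e powr p)"
    using assms False p by (intro sum_strict_mono powr_less_mono2) auto
  then have "1 / real (card A) * ?S < e powr p" using cA by (simp add: field_simps)
  then have "(1 / real (card A) * ?S) powr (1 / p) < (e powr p) powr (1 / p)"
    using p by (intro powr_less_mono2) (auto simp: sum_nonneg)
  also have "\<dots> = e" using p assms(3) by (simp add: powr_powr)
  finally show ?thesis using False by (simp add: rho_dist_def p_def)
qed

text \<open>In the mean of the squares, positions outside \<open>B\<close> contribute at most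
  \<open>e\<^sup>2 / 4\<close> and those in \<open>B\<close> less than \<open>e\<^sup>2 / 2\<close>,
  which together stays below \<open>e\<^sup>2\<close>.\<close>

lemma rho_dist_2_less:
  assumes "finite A" "0 < e" "0 \<le> M" "M\<^sup>2 * \<theta> < e\<^sup>2 / 2"
    and B: "B \<subseteq> A" "real (card B) \<le> \<theta> * real (card A)"
    and nonneg: "\<And>a. a \<in> A \<Longrightarrow> 0 \<le> \<rho> (\<phi> a) (\<psi> a)"
    and bd: "\<And>a. a \<in> A \<Longrightarrow> \<rho> (\<phi> a) (\<psi> a) \<le> M"
    and good: "\<And>a. a \<in> A - B \<Longrightarrow> \<rho> (\<phi> a) (\<psi> a) < e / 2"
  shows "rho_dist \<rho> 2 A \<phi> \<psi> < e"
proof (cases "A = {}")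
  case True
  then show ?thesis using assms by (simp add: rho_dist_def)
next
  case False
  have cA: "0 < card A" using assms(1) False by (simp add: card_gt_0_iff)
  have fB: "finite B" using B(1) assms(1) by (rule finite_subset)
  let ?S = "\<Sum>a\<in>A. \<rho> (\<phi> a) (\<psi> a) powr 2"
  have "?S = (\<Sum>a\<in>A. (\<rho> (\<phi> a) (\<psi> a))\<^sup>2)"
    using nonneg by (intro sum.cong) auto
  also have "\<dots> \<le> (\<Sum>a\<in>A. e\<^sup>2 / 4 + (if a \<in> B then M\<^sup>2 else 0))"
  proof (rule sum_mono)
    fix a assume a: "a \<in> A"
    show "(\<rho> (\<phi> a) (\<psi> a))\<^sup>2 \<le> e\<^sup>2 / 4 + (if a \<in> B then M\<^sup>2 else 0)"
    proof (cases "a \<in> B")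
      case True
      have "(\<rho> (\<phi> a) (\<psi> a))\<^sup>2 \<le> M\<^sup>2" using a bd nonneg by (intro power_mono) auto
      then show ?thesis using True by (simp add: add_increasing)
    next
      case False
      have "(\<rho> (\<phi> a) (\<psi> a))\<^sup>2 \<le> (e / 2)\<^sup>2"
        using a good[of a] nonneg False by (intro power_mono) auto
      then show ?thesis using False by (simp add: power_divide)
    qed
  qed
  also have "\<dots> = real (card A) * (e\<^sup>2 / 4) + real (card B) * M\<^sup>2"
  proof -
    have "A \<inter> B = B" using B by auto
    then show ?thesis using assms(1) by (simp add: sum.distrib flip: sum.inter_restrict)
  qed
  also have "\<dots> \<le> real (card A) * (e\<^sup>2 / 4) + \<theta> * real (card A) * M\<^sup>2"
    using B(2) by (intro add_left_mono mult_right_mono) auto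
  also have "\<dots> = real (card A) * (e\<^sup>2 / 4 + M\<^sup>2 * \<theta>)" by (simp add: algebra_simps)
  also have "\<dots> < real (card A) * e\<^sup>2"
  proof (rule mult_strict_left_mono)
    have "0 < e\<^sup>2" using assms(2) by simp
    then show "e\<^sup>2 / 4 + M\<^sup>2 * \<theta> < e\<^sup>2" using assms(4) by linarith
  qed (use cA in simp)
  finally have "1 / real (card A) * ?S < e powr 2" using cA assms(2) by (simp add: field_simps)
  then have "(1 / real (card A) * ?S) powr (1 / 2) < (e powr 2) powr (1 / 2)"
    by (intro powr_less_mono2) (auto simp: sum_nonneg)
  also have "\<dots> = e" using assms(2) by (simp only: powr_powr) simp
  finally show ?thesis by (simp add: rho_dist_def)
qed

section \<open>Comparison of pseudometrics by compactness\<close>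

lemma continuous_pseudometric_bounded:
  assumes "compact_space X" "continuous_pseudometric X \<rho>"
  obtains M where "0 \<le> M" "\<And>x y. \<lbrakk>x \<in> topspace X; y \<in> topspace X\<rbrakk> \<Longrightarrow> \<rho> x y \<le> M"
proof -
  have "compactin (prod_topology X X) (topspace (prod_topology X X))"
    using assms(1) unfolding compact_space_def[symmetric] by (simp add: compact_space_prod_topology)
  then have "compactin euclideanreal ((\<lambda>(x, y). \<rho> x y) ` topspace (prod_topology X X))"
    by (rule image_compactin) (use assms(2) in \<open>simp add: continuous_pseudometric_def\<close>)
  then have "bounded ((\<lambda>(x, y). \<rho> x y) ` (topspace X \<times> topspace X))"
    by (simp add: compact_imp_bounded)
  then obtain M where "\<And>x y. \<lbrakk>x \<in> topspace X; y \<in> topspace X\<rbrakk> \<Longrightarrow> \<bar>\<rho> x y\<bar> \<le> M"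
    unfolding bounded_iff by fastforce
  then show ?thesis
    by (intro that[of "max 0 M"]) (auto simp: abs_le_iff le_max_iff_disj)
qed

text \<open>The pairs with \<rho>' at least \<eta> form a compact set off the diagonal. Each is
  separated by \<rho> along some group element, which is an open condition; a finite subcover
  provides \<open>E\<close> and \<open>t\<close>.\<close>

lemma dynamically_generating_uniform:
  assumes X: "compact_space X" and act: "action_by_homeomorphisms G X \<alpha>"
    and \<rho>: "continuous_pseudometric X \<rho>" "dynamically_generating G X \<alpha> \<rho>"
    and \<rho>': "continuous_pseudometric X \<rho>'" and "0 < \<eta>"
  obtains E t where "finite E" "E \<subseteq> carrier G" "0 < t"
    "\<And>x y. \<lbrakk>x \<in> topspace X; y \<in> topspace X; \<And>h. h \<in> E \<Longrightarrow> \<rho> (\<alpha> h x) (\<alpha> h y) < t\<rbrakk> \<Longrightarrow> \<rho>' x y < \<eta>"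
proof -
  let ?P = "prod_topology X X"
  have P: "compact_space ?P" using X by (simp add: compact_space_prod_topology)
  define Z where "Z = {p \<in> topspace ?P. (\<lambda>(x, y). \<rho>' x y) p \<in> {\<eta>..}}"
  define U where "U g n = {p \<in> topspace ?P. (\<lambda>(x, y). \<rho> (\<alpha> g x) (\<alpha> g y)) p \<in> {1 / real (Suc n)<..}}" for g n
  have "closedin ?P Z"
    unfolding Z_def
    by (rule closedin_continuous_map_preimage) (use \<rho>' in \<open>auto simp: continuous_pseudometric_def\<close>)
  then have Z: "compactin ?P Z" using P by (rule closedin_compact_space[rotated])
  have op: "openin ?P (U g n)" if g: "g \<in> carrier G" for g n
  proof -
    have "continuous_map X X (\<alpha> g)"
      using act g by (auto simp: action_by_homeomorphisms_def homeomorphic_imp_continuous_map)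
    then have "continuous_map ?P ?P (\<lambda>p. (\<alpha> g (fst p), \<alpha> g (snd p)))"
      by (intro continuous_map_pairedI) (auto intro: continuous_map_compose[OF continuous_map_fst, unfolded o_def] continuous_map_compose[OF continuous_map_snd, unfolded o_def])
    then have "continuous_map ?P euclideanreal ((\<lambda>(x, y). \<rho> x y) \<circ> (\<lambda>p. (\<alpha> g (fst p), \<alpha> g (snd p))))"
      by (rule continuous_map_compose) (use \<rho> in \<open>simp add: continuous_pseudometric_def\<close>)
    then have "continuous_map ?P euclideanreal (\<lambda>(x, y). \<rho> (\<alpha> g x) (\<alpha> g y))"
      by (simp add: o_def case_prod_unfold)
    then show ?thesis unfolding U_def by (rule openin_continuous_map_preimage) auto
  qed
  have "Z \<subseteq> (\<Union>(g, n)\<in>carrier G \<times> UNIV. U g n)"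
  proof
    fix p assume p: "p \<in> Z"
    obtain x y where xy: "p = (x, y)" "x \<in> topspace X" "y \<in> topspace X" "\<eta> \<le> \<rho>' x y"
      using p by (auto simp: Z_def)
    have "x \<noteq> y" using xy \<rho>' \<open>0 < \<eta>\<close> by (auto simp: continuous_pseudometric_def)
    then obtain g where g: "g \<in> carrier G" "0 < \<rho> (\<alpha> g x) (\<alpha> g y)"
      using \<rho>(2) xy by (auto simp: dynamically_generating_def)
    then obtain n where "1 / real (Suc n) < \<rho> (\<alpha> g x) (\<alpha> g y)"
      using nat_approx_posE by blast
    then have "p \<in> U g n" using xy by (auto simp: U_def)
    then show "p \<in> (\<Union>(g, n)\<in>carrier G \<times> UNIV. U g n)" using g by auto
  qed
  moreover have "\<forall>V\<in>(\<lambda>(g, n). U g n) ` (carrier G \<times> UNIV). openin ?P V" using op by auto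
  ultimately obtain \<F> where \<F>: "finite \<F>" "\<F> \<subseteq> (\<lambda>(g, n). U g n) ` (carrier G \<times> UNIV)" "Z \<subseteq> \<Union>\<F>"
    using Z unfolding compactin_def by blast
  then obtain I where I: "finite I" "I \<subseteq> carrier G \<times> (UNIV :: nat set)" "\<F> = (\<lambda>(g, n). U g n) ` I"
    by (meson finite_subset_image)
  \<comment> \<open>The inserted 1 keeps the minimum meaningful when the subcover is empty.\<close>
  define t where "t = Min (insert 1 ((\<lambda>(g, n). 1 / real (Suc n)) ` I))"
  show ?thesis
  proof (rule that[of "fst ` I" t])
    show "finite (fst ` I)" "fst ` I \<subseteq> carrier G" "0 < t"
      using I by (auto simp: t_def)
  next
    fix x y assume xy: "x \<in> topspace X" "y \<in> topspace X"
      and small: "\<And>h. h \<in> fst ` I \<Longrightarrow> \<rho> (\<alpha> h x) (\<alpha> h y) < t"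
    show "\<rho>' x y < \<eta>"
    proof (rule ccontr)
      assume "\<not> ?thesis"
      then have "(x, y) \<in> Z" using xy by (auto simp: Z_def)
      then obtain g n where gn: "(g, n) \<in> I" "(x, y) \<in> U g n" using \<F> I by blast
      then have "t \<le> 1 / real (Suc n)" unfolding t_def using I by (intro Min_le) force+
      moreover have "\<rho> (\<alpha> g x) (\<alpha> g y) < t" using gn small by force
      ultimately show False using gn by (auto simp: U_def)
    qed
  qed
qed

section \<open>Approximately equivariant maps for two pseudometrics\<close>

text \<open>At most positions \<open>j\<close>, \<open>h \<phi>(s g j)\<close> is close to
  \<open>\<phi>(s h (s g j)) = \<phi>(s (h g) j)\<close>, which is close to
  \<open>h g \<phi>(j)\<close>. So \<open>\<phi>(s g j)\<close> and \<open>g \<phi>(j)\<close> are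
  \<rho>-close along \<open>E\<close>, hence \<rho>'-close; the few other positions are controlled
  by the bound \<open>M\<close>. The middle equality is asymptotic, whence only late stages are
  covered.\<close>

lemma Map_approx_eventually_subset:
  assumes G: "group G" and sofic: "sofic_approximation G d \<sigma>"
    and X: "compact_space X" and act: "action_by_homeomorphisms G X \<alpha>"
    and \<rho>: "continuous_pseudometric X \<rho>" "dynamically_generating G X \<alpha> \<rho>"
    and \<rho>': "continuous_pseudometric X \<rho>'"
    and F': "finite F'" "F' \<subseteq> carrier G" and "0 < \<delta>'"
  obtains F \<delta> where "finite F" "F \<subseteq> carrier G" "0 < \<delta>"
    "\<forall>\<^sub>F i in sequentially. Map_approx X \<alpha> \<rho> F \<delta> (d i) (\<sigma> i) \<subseteq> Map_approx X \<alpha> \<rho>' F' \<delta>' (d i) (\<sigma> i)"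
proof -
  interpret group G by fact
  have ga: "group_action G (topspace X) \<alpha>" using act by (simp add: action_by_homeomorphisms_def)
  note mem = group_action.element_image[OF ga _ _ refl]
  obtain M where M: "0 \<le> M" "\<And>x y. \<lbrakk>x \<in> topspace X; y \<in> topspace X\<rbrakk> \<Longrightarrow> \<rho>' x y \<le> M"
    using continuous_pseudometric_bounded[OF X \<rho>'] by blast
  obtain E t where E: "finite E" "E \<subseteq> carrier G" "0 < t"
    and t: "\<And>x y. \<lbrakk>x \<in> topspace X; y \<in> topspace X; \<And>h. h \<in> E \<Longrightarrow> \<rho> (\<alpha> h x) (\<alpha> h y) < t\<rbrakk>
      \<Longrightarrow> \<rho>' x y < \<delta>' / 2"
    using dynamically_generating_uniform[OF X act \<rho> \<rho>', of "\<delta>' / 2"] \<open>0 < \<delta>'\<close> half_gt_zero by metis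
  define \<theta> where "\<theta> = \<delta>'\<^sup>2 / (2 * (M\<^sup>2 + 1))"
  have M1: "0 < M\<^sup>2 + 1" by (simp add: add_nonneg_pos)
  have \<theta>0: "0 < \<theta>" using \<open>0 < \<delta>'\<close> M1 by (simp add: \<theta>_def)
  have "M\<^sup>2 * \<delta>'\<^sup>2 < (M\<^sup>2 + 1) * \<delta>'\<^sup>2" using \<open>0 < \<delta>'\<close> by simp
  then have \<theta>: "M\<^sup>2 * \<theta> < \<delta>'\<^sup>2 / 2" using M1 by (simp add: \<theta>_def field_simps)
  \<comment> \<open>Each \<open>h\<close> in \<open>E\<close> has three sources of failure, each of
    proportion at most \<tau>; altogether they take at most \<theta>. The added 1 covers an empty
    \<open>E\<close>.\<close>
  define \<tau> where "\<tau> = \<theta> / (3 * (real (card E) + 1))"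
  have \<tau>0: "0 < \<tau>" using \<theta>0 by (simp add: \<tau>_def add_nonneg_pos)
  have \<tau>: "real (card E) * (3 * \<tau>) \<le> \<theta>"
  proof -
    have "0 < 3 * (real (card E) + 1)" by simp
    then have "\<theta> = \<tau> * (3 * (real (card E) + 1))"
      unfolding \<tau>_def by (metis less_irrefl nonzero_eq_divide_eq)
    then show ?thesis using \<tau>0 by (simp add: algebra_simps)
  qed
  \<comment> \<open>Markov's inequality at threshold \<open>t / 2\<close> then gives a failure
    proportion of at most \<tau>; the minimum with 1 secures
    \<open>\<delta> \<le> t / 2\<close>.\<close>
  define \<delta> where "\<delta> = min \<tau> 1 * (t / 2)"
  have \<delta>: "0 < \<delta>" "\<delta> \<le> t / 2" "\<delta> / (t / 2) \<le> \<tau>"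
    using \<tau>0 E(3) by (auto simp: \<delta>_def)
  define F where "F = E \<union> (\<lambda>(h, g). h \<otimes>\<^bsub>G\<^esub> g) ` (E \<times> F')"
  have F: "finite F" "F \<subseteq> carrier G" using E F' by (auto simp: F_def)
  have d1: "1 \<le> d i" for i using sofic by (simp add: sofic_approximation_def)
  have perm: "\<sigma> i g permutes {1..d i}" if "g \<in> carrier G" for i g
    using sofic that by (simp add: sofic_approximation_def sym_group_carrier)
  let ?agree = "\<lambda>i h g. {j \<in> {1..d i}. \<sigma> i (h \<otimes>\<^bsub>G\<^esub> g) j = \<sigma> i h (\<sigma> i g j)}"
  have "\<forall>\<^sub>F i in sequentially. \<forall>p\<in>E \<times> F'. 1 - \<tau> < unif (d i) (?agree i (fst p) (snd p))"
  proof (rule eventually_ball_finite)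
    show "\<forall>p\<in>E \<times> F'. \<forall>\<^sub>F i in sequentially. 1 - \<tau> < unif (d i) (?agree i (fst p) (snd p))"
    proof
      fix p assume "p \<in> E \<times> F'"
      then have "fst p \<in> carrier G" "snd p \<in> carrier G" using E F' by auto
      then have "(\<lambda>i. unif (d i) (?agree i (fst p) (snd p))) \<longlonglongrightarrow> 1"
        using sofic unfolding sofic_approximation_def by blast
      then show "\<forall>\<^sub>F i in sequentially. 1 - \<tau> < unif (d i) (?agree i (fst p) (snd p))"
        by (rule order_tendstoD) (use \<tau>0 in simp)
    qed
  qed (use E F' in simp)
  then have "\<forall>\<^sub>F i in sequentially. Map_approx X \<alpha> \<rho> F \<delta> (d i) (\<sigma> i) \<subseteq> Map_approx X \<alpha> \<rho>' F' \<delta>' (d i) (\<sigma> i)"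
  proof eventually_elim
    case (elim i)
    define n where "n = d i"
    define s where "s = \<sigma> i"
    have ps: "s g permutes {1..n}" if "g \<in> carrier G" for g using perm[OF that] by (simp add: s_def n_def)
    show ?case
    proof
      fix \<phi> assume "\<phi> \<in> Map_approx X \<alpha> \<rho> F \<delta> (d i) (\<sigma> i)"
      then have \<phi>: "\<phi> \<in> {1..n} \<rightarrow>\<^sub>E topspace X"
        and small: "\<And>g. g \<in> F \<Longrightarrow> rho_dist \<rho> 2 {1..n} (\<phi> \<circ> s g) (\<lambda>j. \<alpha> g (\<phi> j)) < \<delta>"
        by (auto simp: Map_approx_def n_def s_def)
      have \<phi>X: "\<phi> j \<in> topspace X" if "j \<in> {1..n}" for j using \<phi> that by auto
      have sX: "s g j \<in> {1..n}" if "g \<in> carrier G" "j \<in> {1..n}" for g j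
        using permutes_in_image[OF ps[OF that(1)]] that(2) by blast
      define L where "L g = {j \<in> {1..n}. t / 2 \<le> \<rho> ((\<phi> \<circ> s g) j) (\<alpha> g (\<phi> j))}" for g
      have L: "real (card (L g)) \<le> \<tau> * real n" if g: "g \<in> F" for g
      proof -
        have gc: "g \<in> carrier G" using g F by auto
        have "real (card (L g)) \<le> \<delta> / (t / 2) * real (card {1..n})"
          unfolding L_def
        proof (rule card_large_le_rho_dist[where q = 2 and e = \<delta> and \<rho> = \<rho>
              and \<phi> = "\<phi> \<circ> s g" and \<psi> = "\<lambda>j. \<alpha> g (\<phi> j)"])
          fix j assume "j \<in> {1..n}"
          then show "0 \<le> \<rho> ((\<phi> \<circ> s g) j) (\<alpha> g (\<phi> j))"
            using \<rho>(1) \<phi>X sX mem gc by (simp add: continuous_pseudometric_def)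
        qed (use \<delta> small[OF g] in auto)
        also have "\<dots> \<le> \<tau> * real n" using mult_right_mono[OF \<delta>(3), of "real n"] by simp
        finally show ?thesis .
      qed
      have "rho_dist \<rho>' 2 {1..n} (\<phi> \<circ> s g) (\<lambda>j. \<alpha> g (\<phi> j)) < \<delta>'" if g: "g \<in> F'" for g
      proof -
        have gc: "g \<in> carrier G" using g F' by auto
        define N where "N h = {j \<in> {1..n}. s (h \<otimes>\<^bsub>G\<^esub> g) j \<noteq> s h (s g j)}" for h
        \<comment> \<open>The three failures: equivariance under \<open>h\<close> at the point
          \<open>s g j\<close>, multiplicativity at \<open>j\<close>, and equivariance under the
          product \<open>h g\<close> at \<open>j\<close>.\<close>
        define B where "B h = {j \<in> {1..n}. s g j \<in> L h} \<union> N h \<union> L (h \<otimes>\<^bsub>G\<^esub> g)" for h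
        have B: "real (card (B h)) \<le> 3 * \<tau> * real n" if h: "h \<in> E" for h
        proof -
          have hF: "h \<in> F" "h \<otimes>\<^bsub>G\<^esub> g \<in> F" using h g by (auto simp: F_def)
          \<comment> \<open>The permutation \<open>s g\<close> is injective, so pulling
            \<open>L h\<close> back along it does not enlarge it.\<close>
          have "card {j \<in> {1..n}. s g j \<in> L h} \<le> card (L h)"
            by (rule card_inj_on_le[of "s g"])
              (use permutes_inj_on[OF ps[OF gc]] in \<open>auto simp: L_def\<close>)
          then have 1: "real (card {j \<in> {1..n}. s g j \<in> L h}) \<le> \<tau> * real n"
            using L[OF hF(1)] by linarith
          have "1 - \<tau> < unif n {j \<in> {1..n}. s (h \<otimes>\<^bsub>G\<^esub> g) j = s h (s g j)}"
            using elim h g by (auto simp: n_def s_def)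
          also have "\<dots> = real (card {j \<in> {1..n}. s (h \<otimes>\<^bsub>G\<^esub> g) j = s h (s g j)}) / real n"
            unfolding unif_def by (subst measure_uniform_count_measure) auto
          also have "{j \<in> {1..n}. s (h \<otimes>\<^bsub>G\<^esub> g) j = s h (s g j)} = {1..n} - N h"
            by (auto simp: N_def)
          also have "card \<dots> = n - card (N h)"
            by (subst card_Diff_subset) (auto simp: N_def)
          also have "real \<dots> = real n - real (card (N h))"
          proof -
            have "card (N h) \<le> card {1..n}" by (rule card_mono) (auto simp: N_def)
            then show ?thesis by (simp add: of_nat_diff)
          qed
          finally have 2: "real (card (N h)) \<le> \<tau> * real n"
            using d1[of i] by (simp add: n_def field_simps)
          have "card (B h) \<le> card {j \<in> {1..n}. s g j \<in> L h} + card (N h) + card (L (h \<otimes>\<^bsub>G\<^esub> g))"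
            unfolding B_def by (meson add_right_mono card_Un_le order_trans)
          then show ?thesis using 1 2 L[OF hF(2)] by linarith
        qed
        show ?thesis
        proof (rule rho_dist_2_less[where B = "\<Union>h\<in>E. B h" and M = M and \<theta> = \<theta>])
          show "(\<Union>h\<in>E. B h) \<subseteq> {1..n}" by (auto simp: B_def L_def N_def)
          have "card (\<Union>h\<in>E. B h) \<le> (\<Sum>h\<in>E. card (B h))" using E(1) by (rule card_UN_le)
          then have "real (card (\<Union>h\<in>E. B h)) \<le> (\<Sum>h\<in>E. real (card (B h)))"
            unfolding of_nat_sum[symmetric] of_nat_le_iff .
          also have "\<dots> \<le> (\<Sum>h\<in>E. 3 * \<tau> * real n)" using B by (rule sum_mono)
          also have "\<dots> = real (card E) * (3 * \<tau>) * real n" by simp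
          also have "\<dots> \<le> \<theta> * real n" using \<tau> by (rule mult_right_mono) simp
          finally show "real (card (\<Union>h\<in>E. B h)) \<le> \<theta> * real (card {1..n})" by simp
        next
          fix j assume j: "j \<in> {1..n}"
          then show "0 \<le> \<rho>' ((\<phi> \<circ> s g) j) (\<alpha> g (\<phi> j))"
            using \<rho>' \<phi>X sX mem gc by (simp add: continuous_pseudometric_def)
          show "\<rho>' ((\<phi> \<circ> s g) j) (\<alpha> g (\<phi> j)) \<le> M"
            using j \<phi>X sX mem gc by (intro M) auto
        next
          fix j assume j: "j \<in> {1..n} - (\<Union>h\<in>E. B h)"
          then have jn: "j \<in> {1..n}" by simp
          have sj: "s g j \<in> {1..n}" using sX[OF gc jn] .
          show "\<rho>' ((\<phi> \<circ> s g) j) (\<alpha> g (\<phi> j)) < \<delta>' / 2"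
          proof (rule t)
            show "(\<phi> \<circ> s g) j \<in> topspace X" "\<alpha> g (\<phi> j) \<in> topspace X"
              using \<phi>X sj jn mem[OF gc] by auto
          next
            fix h assume h: "h \<in> E"
            then have hc: "h \<in> carrier G" using E by auto
            have nB: "j \<notin> B h" using j h by blast
            let ?a = "\<alpha> h (\<phi> (s g j))" and ?b = "\<phi> (s h (s g j))" and ?c = "\<alpha> h (\<alpha> g (\<phi> j))"
            have b: "?b = \<phi> (s (h \<otimes>\<^bsub>G\<^esub> g) j)" using nB jn by (simp add: B_def N_def)
            have c: "?c = \<alpha> (h \<otimes>\<^bsub>G\<^esub> g) (\<phi> j)"
              using group_action.composition_rule[OF ga \<phi>X[OF jn] hc gc] by simp
            have in_X: "?a \<in> topspace X" "?b \<in> topspace X" "?c \<in> topspace X"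
              using \<phi>X sX sj jn hc gc mem by auto
            have "s g j \<notin> L h" using nB jn by (simp add: B_def)
            then have 1: "\<rho> ?b ?a < t / 2" using sj by (simp add: L_def)
            have "j \<notin> L (h \<otimes>\<^bsub>G\<^esub> g)" using nB by (simp add: B_def)
            then have 2: "\<rho> ?b ?c < t / 2" using jn by (simp add: L_def b c)
            have "\<rho> ?a ?c \<le> \<rho> ?a ?b + \<rho> ?b ?c" "\<rho> ?a ?b = \<rho> ?b ?a"
              using \<rho>(1) in_X unfolding continuous_pseudometric_def by blast+
            then show "\<rho> (\<alpha> h ((\<phi> \<circ> s g) j)) (\<alpha> h (\<alpha> g (\<phi> j))) < t"
              using 1 2 by simp
          qed
        qed (use M \<theta> \<open>0 < \<delta>'\<close> in auto)
      qed
      then show "\<phi> \<in> Map_approx X \<alpha> \<rho>' F' \<delta>' (d i) (\<sigma> i)"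
        using \<phi> by (simp add: Map_approx_def n_def s_def)
    qed
  qed
  then show ?thesis using that[OF F \<delta>(1)] by blast
qed

section \<open>Independence densities and the comparison of tuples\<close>

lemma unif_eq: "A \<subseteq> {1..n} \<Longrightarrow> unif n A = real (card A) / real n"
  unfolding unif_def by (subst measure_uniform_count_measure) auto

lemma unif_le_indep_density_at:
  assumes "independence_set X \<alpha> \<rho> k q x F \<delta> n s \<epsilon> K J"
  shows "unif n J \<le> indep_density_at X \<alpha> \<rho> k q x F \<delta> n s \<epsilon> K"
proof -
  have "finite {J. independence_set X \<alpha> \<rho> k q x F \<delta> n s \<epsilon> K J}"
    by (rule finite_subset[of _ "Pow {1..n}"]) (auto simp: independence_set_def)
  then show ?thesis using assms by (auto simp: indep_density_at_def intro!: Max_ge)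
qed

lemma indep_density_at_cases:
  obtains "indep_density_at X \<alpha> \<rho> k q x F \<delta> n s \<epsilon> K = 0"
  | J where "independence_set X \<alpha> \<rho> k q x F \<delta> n s \<epsilon> K J"
      "indep_density_at X \<alpha> \<rho> k q x F \<delta> n s \<epsilon> K = unif n J"
proof (cases "\<exists>J. independence_set X \<alpha> \<rho> k q x F \<delta> n s \<epsilon> K J")
  case True
  let ?I = "{J. independence_set X \<alpha> \<rho> k q x F \<delta> n s \<epsilon> K J}"
  have "finite ?I"
    by (rule finite_subset[of _ "Pow {1..n}"]) (auto simp: independence_set_def)
  then have "Max (unif n ` ?I) \<in> unif n ` ?I" using True by (intro Max_in) auto
  then show ?thesis using that(2) True by (auto simp: indep_density_at_def)
next
  case False
  then show ?thesis using that(1) by (simp add: indep_density_at_def)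
qed

lemma indep_density_at_nonneg: "0 \<le> indep_density_at X \<alpha> \<rho> k q x F \<delta> n s \<epsilon> K"
  by (rule indep_density_at_cases[of X \<alpha> \<rho> k q x F \<delta> n s \<epsilon> K]) (auto simp: unif_def)

text \<open>Passing from \<open>J\<close> to \<open>W\<close> costs a factor \<kappa> that depends
  only on \<open>k\<close>, not on the stage or on the equivariance parameters. Positivity therefore
  survives the limit superior and the infimum.\<close>

lemma IE_tuples_subset:
  fixes G :: "('g, 'm) monoid_scheme"
  assumes G: "group G" and sofic: "sofic_approximation G d \<sigma>"
    and X: "compact_space X" and act: "action_by_homeomorphisms G X \<alpha>"
    and \<rho>: "continuous_pseudometric X \<rho>" "dynamically_generating G X \<alpha> \<rho>"
    and \<rho>': "continuous_pseudometric X \<rho>'"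
    and k: "1 \<le> k" and q: "1 \<le> q" "1 \<le> q'"
  shows "IE_tuples G X \<alpha> d \<sigma> \<rho> k q \<subseteq> IE_tuples G X \<alpha> d \<sigma> \<rho>' k q'"
proof
  interpret group G by fact
  have ga: "group_action G (topspace X) \<alpha>" using act by (simp add: action_by_homeomorphisms_def)
  note mem = group_action.element_image[OF ga _ _ refl]
  fix x assume "x \<in> IE_tuples G X \<alpha> d \<sigma> \<rho> k q"
  then have x: "x \<in> {1..k} \<rightarrow>\<^sub>E topspace X"
    and pos: "\<And>\<epsilon> K. \<lbrakk>0 < \<epsilon>; finite K; K \<subseteq> carrier G\<rbrakk> \<Longrightarrow> 0 < indep_density G X \<alpha> d \<sigma> \<rho> k q x \<epsilon> K"
    by (auto simp: IE_tuples_def)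
  have xX: "x v \<in> topspace X" if "v \<in> {1..k}" for v using x that by auto
  obtain \<kappa> :: real where \<kappa>: "0 < \<kappa>"
    and indep: "\<And>(J :: nat set) (B :: (nat \<Rightarrow> nat) \<Rightarrow> nat set) A. \<lbrakk>finite J; finite A; card A = k;
        \<And>f. f \<in> J \<rightarrow>\<^sub>E A \<Longrightarrow> B f \<subseteq> J \<and> real (card (B f)) \<le> \<kappa> * real (card J)\<rbrakk> \<Longrightarrow>
        \<exists>W\<subseteq>J. \<kappa> * real (card J) \<le> real (card W) \<and>
          (\<forall>c\<in>W \<rightarrow> A. \<exists>f\<in>J \<rightarrow>\<^sub>E A. (\<forall>w\<in>W. f w = c w) \<and> W \<inter> B f = {})"
    using independence_constant[OF k] by blast
  have "0 < indep_density G X \<alpha> d \<sigma> \<rho>' k q' x \<epsilon>' K'"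
    if \<epsilon>': "0 < \<epsilon>'" and K': "finite K'" "K' \<subseteq> carrier G" for \<epsilon>' K'
  proof -
    obtain E t where E: "finite E" "E \<subseteq> carrier G" "0 < t"
      and t: "\<And>x y. \<lbrakk>x \<in> topspace X; y \<in> topspace X; \<And>h. h \<in> E \<Longrightarrow> \<rho> (\<alpha> h x) (\<alpha> h y) < t\<rbrakk>
        \<Longrightarrow> \<rho>' x y < \<epsilon>'"
      using dynamically_generating_uniform[OF X act \<rho> \<rho>' \<epsilon>'] by metis
    \<comment> \<open>Closeness for \<rho>' after applying \<open>g\<close> follows from closeness
      for \<rho> after applying all \<open>h g\<close> with \<open>h\<close> in
      \<open>E\<close>.\<close>
    define K where "K = (\<lambda>(h, g). h \<otimes>\<^bsub>G\<^esub> g) ` (E \<times> K')"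
    have K: "finite K" "K \<subseteq> carrier G" using E K' by (auto simp: K_def)
    \<comment> \<open>By Markov's inequality each element of \<open>K\<close> spoils at most the
      proportion \<open>\<epsilon> / t\<close> of \<open>J\<close>, in total at most \<kappa>. The
      added 1 covers an empty \<open>K\<close>, and the minimum with 1 gives
      \<open>\<epsilon> \<le> t\<close>.\<close>
    define \<epsilon> where "\<epsilon> = min 1 (\<kappa> / (real (card K) + 1)) * t"
    have \<epsilon>: "0 < \<epsilon>" "\<epsilon> \<le> t" using E(3) \<kappa> by (auto simp: \<epsilon>_def add_nonneg_pos)
    have \<epsilon>K: "real (card K) * (\<epsilon> / t) \<le> \<kappa>"
    proof -
      have "\<epsilon> / t \<le> \<kappa> / (real (card K) + 1)" using E(3) by (simp add: \<epsilon>_def)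
      then have "(real (card K) + 1) * (\<epsilon> / t) \<le> \<kappa>" by (simp add: pos_le_divide_eq add_nonneg_pos mult.commute)
      moreover have "0 < \<epsilon> / t" using \<epsilon> E(3) by simp
      ultimately show ?thesis unfolding distrib_right by linarith
    qed
    have step: "\<exists>W. independence_set X \<alpha> \<rho>' k q' x F' \<delta>' n s \<epsilon>' K' W \<and> \<kappa> * real (card J) \<le> real (card W)"
      if J: "independence_set X \<alpha> \<rho> k q x F \<delta> n s \<epsilon> K J"
        and sub: "Map_approx X \<alpha> \<rho> F \<delta> n s \<subseteq> Map_approx X \<alpha> \<rho>' F' \<delta>' n s"
      for F \<delta> F' \<delta>' n s J
    proof -
      have Jn: "J \<subseteq> {1..n}" and "\<forall>c\<in>J \<rightarrow>\<^sub>E {1..k}. \<exists>\<phi>\<in>Map_approx X \<alpha> \<rho> F \<delta> n s.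
          \<forall>g\<in>K. rho_dist \<rho> q J (\<lambda>j. \<alpha> g (\<phi> j)) (\<lambda>j. \<alpha> g (x (c j))) < \<epsilon>"
        using J by (auto simp: independence_set_def PiE_def)
      then obtain \<Phi> where \<Phi>: "\<And>c. c \<in> J \<rightarrow>\<^sub>E {1..k} \<Longrightarrow> \<Phi> c \<in> Map_approx X \<alpha> \<rho> F \<delta> n s"
        and close: "\<And>c g. \<lbrakk>c \<in> J \<rightarrow>\<^sub>E {1..k}; g \<in> K\<rbrakk> \<Longrightarrow>
          rho_dist \<rho> q J (\<lambda>j. \<alpha> g (\<Phi> c j)) (\<lambda>j. \<alpha> g (x (c j))) < \<epsilon>"
        by metis
      have finJ: "finite J" using Jn by (rule finite_subset) simp
      have \<Phi>X: "\<Phi> c j \<in> topspace X" if "c \<in> J \<rightarrow>\<^sub>E {1..k}" "j \<in> J" for c j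
        using \<Phi>[OF that(1)] that(2) Jn by (auto simp: Map_approx_def)
      have cX: "x (c j) \<in> topspace X" if "c \<in> J \<rightarrow>\<^sub>E {1..k}" "j \<in> J" for c j
        using that by (intro xX) auto
      \<comment> \<open>The positions where the chosen model of \<open>c\<close> is not within
        \<open>t\<close> of its target for some element of \<open>K\<close>.\<close>
      define B where "B c = (\<Union>g\<in>K. {j \<in> J. t \<le> \<rho> (\<alpha> g (\<Phi> c j)) (\<alpha> g (x (c j)))})" for c
      have B: "B c \<subseteq> J \<and> real (card (B c)) \<le> \<kappa> * real (card J)" if c: "c \<in> J \<rightarrow>\<^sub>E {1..k}" for c
      proof
        show "B c \<subseteq> J" by (auto simp: B_def)
        have "card (B c) \<le> (\<Sum>g\<in>K. card {j \<in> J. t \<le> \<rho> (\<alpha> g (\<Phi> c j)) (\<alpha> g (x (c j)))})"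
          unfolding B_def using K(1) by (rule card_UN_le)
        then have "real (card (B c)) \<le> (\<Sum>g\<in>K. real (card {j \<in> J. t \<le> \<rho> (\<alpha> g (\<Phi> c j)) (\<alpha> g (x (c j)))}))"
          unfolding of_nat_sum[symmetric] of_nat_le_iff .
        also have "\<dots> \<le> (\<Sum>g\<in>K. \<epsilon> / t * real (card J))"
        proof (rule sum_mono)
          fix g assume g: "g \<in> K"
          show "real (card {j \<in> J. t \<le> \<rho> (\<alpha> g (\<Phi> c j)) (\<alpha> g (x (c j)))}) \<le> \<epsilon> / t * real (card J)"
          proof (rule card_large_le_rho_dist[OF finJ q(1) \<epsilon>, where \<rho> = \<rho>
                and \<phi> = "\<lambda>j. \<alpha> g (\<Phi> c j)" and \<psi> = "\<lambda>j. \<alpha> g (x (c j))"])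
            show "rho_dist \<rho> q J (\<lambda>j. \<alpha> g (\<Phi> c j)) (\<lambda>j. \<alpha> g (x (c j))) < \<epsilon>"
              using close[OF c g] .
          next
            fix j assume "j \<in> J"
            then show "0 \<le> \<rho> (\<alpha> g (\<Phi> c j)) (\<alpha> g (x (c j)))"
              using \<rho>(1) mem \<Phi>X[OF c] cX[OF c] g K(2) by (auto simp: continuous_pseudometric_def)
          qed
        qed
        also have "\<dots> = real (card K) * (\<epsilon> / t) * real (card J)" by simp
        also have "\<dots> \<le> \<kappa> * real (card J)" using \<epsilon>K by (rule mult_right_mono) simp
        finally show "real (card (B c)) \<le> \<kappa> * real (card J)" .
      qed
      obtain W where W: "W \<subseteq> J" "\<kappa> * real (card J) \<le> real (card W)"
        and ext: "\<And>c. c \<in> W \<rightarrow> {1..k} \<Longrightarrow> \<exists>f\<in>J \<rightarrow>\<^sub>E {1..k}. (\<forall>w\<in>W. f w = c w) \<and> W \<inter> B f = {}"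
      proof -
        have "card {1..k} = k" by simp
        from indep[of J "{1..k}" B, OF finJ finite_atLeastAtMost this B] that show ?thesis by blast
      qed
      have "independence_set X \<alpha> \<rho>' k q' x F' \<delta>' n s \<epsilon>' K' W"
        unfolding independence_set_def
      proof (intro conjI ballI)
        show "W \<subseteq> {1..n}" using W(1) Jn by (rule subset_trans)
        fix c assume c: "c \<in> W \<rightarrow> {1..k}"
        from ext[OF c] obtain f
          where f: "f \<in> J \<rightarrow>\<^sub>E {1..k}" "\<And>w. w \<in> W \<Longrightarrow> f w = c w" "W \<inter> B f = {}"
          by blast
        show "\<exists>\<phi>\<in>Map_approx X \<alpha> \<rho>' F' \<delta>' n s.
          \<forall>g\<in>K'. rho_dist \<rho>' q' W (\<lambda>j. \<alpha> g (\<phi> j)) (\<lambda>j. \<alpha> g (x (c j))) < \<epsilon>'"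
        proof (intro bexI ballI)
          \<comment> \<open>The model chosen for the extension \<open>f\<close> of \<open>c\<close>
            to \<open>J\<close> is reused; off \<open>B f\<close> it is pointwise accurate.\<close>
          show "\<Phi> f \<in> Map_approx X \<alpha> \<rho>' F' \<delta>' n s" using \<Phi>[OF f(1)] sub by blast
          fix g assume g: "g \<in> K'"
          then have gc: "g \<in> carrier G" using K' by auto
          show "rho_dist \<rho>' q' W (\<lambda>j. \<alpha> g (\<Phi> f j)) (\<lambda>j. \<alpha> g (x (c j))) < \<epsilon>'"
          proof (rule rho_dist_less_of_pointwise[OF _ q(2) \<epsilon>'])
            show "finite W" using W(1) finJ by (rule finite_subset)
          next
            fix j assume j: "j \<in> W"
            have jJ: "j \<in> J" using j W(1) by auto
            have fj: "c j = f j" using f(2)[OF j] by simp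
            have in_X: "\<alpha> g (\<Phi> f j) \<in> topspace X" "\<alpha> g (x (c j)) \<in> topspace X"
              using mem gc \<Phi>X[OF f(1) jJ] cX[OF f(1) jJ] by (auto simp: fj)
            show "0 \<le> \<rho>' (\<alpha> g (\<Phi> f j)) (\<alpha> g (x (c j)))"
              using \<rho>' in_X by (simp add: continuous_pseudometric_def)
            show "\<rho>' (\<alpha> g (\<Phi> f j)) (\<alpha> g (x (c j))) < \<epsilon>'"
            proof (rule t[OF in_X])
              fix h assume h: "h \<in> E"
              then have hc: "h \<in> carrier G" using E by auto
              have "h \<otimes>\<^bsub>G\<^esub> g \<in> K" using h g by (auto simp: K_def)
              moreover have "j \<notin> B f" using j f(3) by blast
              ultimately have "\<rho> (\<alpha> (h \<otimes>\<^bsub>G\<^esub> g) (\<Phi> f j)) (\<alpha> (h \<otimes>\<^bsub>G\<^esub> g) (x (f j))) < t"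
                using jJ by (auto simp: B_def not_le)
              then show "\<rho> (\<alpha> h (\<alpha> g (\<Phi> f j))) (\<alpha> h (\<alpha> g (x (c j)))) < t"
                using group_action.composition_rule[OF ga \<Phi>X[OF f(1) jJ] hc gc]
                  group_action.composition_rule[OF ga cX[OF f(1) jJ] hc gc] by (simp add: fj)
            qed
          qed
        qed
      qed
      then show ?thesis using W(2) by blast
    qed
    have step': "\<kappa> * indep_density_at X \<alpha> \<rho> k q x F \<delta> n s \<epsilon> K \<le> indep_density_at X \<alpha> \<rho>' k q' x F' \<delta>' n s \<epsilon>' K'"
      if sub: "Map_approx X \<alpha> \<rho> F \<delta> n s \<subseteq> Map_approx X \<alpha> \<rho>' F' \<delta>' n s" for F \<delta> F' \<delta>' n s
    proof (rule indep_density_at_cases[of X \<alpha> \<rho> k q x F \<delta> n s \<epsilon> K])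
      fix J assume J: "independence_set X \<alpha> \<rho> k q x F \<delta> n s \<epsilon> K J"
        and eq: "indep_density_at X \<alpha> \<rho> k q x F \<delta> n s \<epsilon> K = unif n J"
      obtain W where W: "independence_set X \<alpha> \<rho>' k q' x F' \<delta>' n s \<epsilon>' K' W" "\<kappa> * real (card J) \<le> real (card W)"
        using step[OF J sub] by blast
      have "\<kappa> * unif n J = \<kappa> * real (card J) / real n" "unif n W = real (card W) / real n"
        using J W(1) by (simp_all add: independence_set_def unif_eq)
      then have "\<kappa> * unif n J \<le> unif n W" using W(2) by (simp add: divide_right_mono)
      also have "\<dots> \<le> indep_density_at X \<alpha> \<rho>' k q' x F' \<delta>' n s \<epsilon>' K'"
        using W(1) by (rule unif_le_indep_density_at)
      finally show ?thesis by (simp add: eq)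
    qed (simp add: indep_density_at_nonneg)
    let ?b = "indep_density G X \<alpha> d \<sigma> \<rho> k q x \<epsilon> K"
    have "0 < ereal \<kappa> * ?b" using pos[OF \<epsilon>(1) K] \<kappa> by (simp add: ereal_zero_less_0_iff)
    also have "\<dots> \<le> indep_density G X \<alpha> d \<sigma> \<rho>' k q' x \<epsilon>' K'"
      unfolding indep_density_def[of G X \<alpha> d \<sigma> \<rho>']
    proof (rule INF_greatest)
      \<comment> \<open>Each competitor in the infimum for \<rho>' is matched with a pair
        \<open>F\<close>, \<delta> for \<rho>, whose limit superior is at least
        \<open>?b\<close>.\<close>
      fix p :: "'g set \<times> real"
      assume "p \<in> {F. finite F \<and> F \<subseteq> carrier G} \<times> {0<..}"
      then obtain F' \<delta>' where p: "p = (F', \<delta>')" and F': "finite F'" "F' \<subseteq> carrier G" and \<delta>': "0 < \<delta>'"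
        by auto
      obtain F \<delta> where F: "finite F" "F \<subseteq> carrier G" "0 < \<delta>" and
        ev: "\<forall>\<^sub>F i in sequentially. Map_approx X \<alpha> \<rho> F \<delta> (d i) (\<sigma> i) \<subseteq> Map_approx X \<alpha> \<rho>' F' \<delta>' (d i) (\<sigma> i)"
        using Map_approx_eventually_subset[OF G sofic X act \<rho> \<rho>' F' \<delta>'] by blast
      have "?b \<le> limsup (\<lambda>i. ereal (indep_density_at X \<alpha> \<rho> k q x F \<delta> (d i) (\<sigma> i) \<epsilon> K))"
        unfolding indep_density_def by (rule INF_lower2[of "(F, \<delta>)"]) (use F in auto)
      then have "ereal \<kappa> * ?b \<le> ereal \<kappa> * limsup (\<lambda>i. ereal (indep_density_at X \<alpha> \<rho> k q x F \<delta> (d i) (\<sigma> i) \<epsilon> K))"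
        using \<kappa> by (intro ereal_mult_left_mono) auto
      also have "\<dots> = limsup (\<lambda>i. ereal \<kappa> * ereal (indep_density_at X \<alpha> \<rho> k q x F \<delta> (d i) (\<sigma> i) \<epsilon> K))"
        using \<kappa> by (intro Limsup_ereal_mult_left[symmetric]) auto
      \<comment> \<open>The inclusion of map spaces holds only eventually, which is enough for a
        limit superior.\<close>
      also have "\<dots> \<le> limsup (\<lambda>i. ereal (indep_density_at X \<alpha> \<rho>' k q' x F' \<delta>' (d i) (\<sigma> i) \<epsilon>' K'))"
        by (rule Limsup_mono) (use ev in eventually_elim, simp add: step')
      finally show "ereal \<kappa> * ?b \<le> (case p of (F', \<delta>') \<Rightarrow>
          limsup (\<lambda>i. ereal (indep_density_at X \<alpha> \<rho>' k q' x F' \<delta>' (d i) (\<sigma> i) \<epsilon>' K')))"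
        by (simp add: p)
    qed
    finally show ?thesis .
  qed
  then show "x \<in> IE_tuples G X \<alpha> d \<sigma> \<rho>' k q'" using x by (simp add: IE_tuples_def)
qed

theorem lemma2p9:
  fixes G :: "('g, 'm) monoid_scheme"
    and X :: "'x topology"
    and \<alpha> :: "'g \<Rightarrow> 'x \<Rightarrow> 'x"
    and d :: "nat \<Rightarrow> nat"
    and \<sigma> :: "nat \<Rightarrow> 'g \<Rightarrow> nat \<Rightarrow> nat"
    and \<rho>1 \<rho>2 :: "'x \<Rightarrow> 'x \<Rightarrow> real"
    and k :: nat
    and q1 q2 :: ereal
  assumes "group G" and "countable (carrier G)"
    and "sofic_approximation G d \<sigma>"
    and "compact_space X" and "metrizable_space X"
    and "action_by_homeomorphisms G X \<alpha>"
    and "continuous_pseudometric X \<rho>1" and "dynamically_generating G X \<alpha> \<rho>1"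
    and "continuous_pseudometric X \<rho>2" and "dynamically_generating G X \<alpha> \<rho>2"
    and "1 \<le> k" and "1 \<le> q1" and "1 \<le> q2"
  shows "IE_tuples G X \<alpha> d \<sigma> \<rho>1 k q1 = IE_tuples G X \<alpha> d \<sigma> \<rho>2 k q2"
  using assms
    IE_tuples_subset[of G d \<sigma> X \<alpha> \<rho>1 \<rho>2 k q1 q2]
    IE_tuples_subset[of G d \<sigma> X \<alpha> \<rho>2 \<rho>1 k q2 q1]
  by (intro subset_antisym) auto

end
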